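(* Let $S=\dot\bigcup_{\alpha\in Y}S_\alpha$ be a semilattice of finite groups $S_\alpha$, where the semilattice $Y$ has a top element $1$. Let $I$ and $\Lambda$ be sets, let $P=(p_{\lambda i})$ be a $\Lambda\times I$ matrix all of whose entries lie in the group $S_1$, and let $T=\mathcal{M}[S;I,\Lambda;P]$ be the Rees matrix semigroup over the semigroup $S$. Then $T$ is completely regular.
   Context: A semigroup $S$ is a semilattice of groups $S_\alpha$ ($\alpha\in Y$), where $Y$ is a (meet-)semilattice, if $S=\dot\bigcup_{\alpha\in Y}S_\alpha$ is a disjoint union of subgroups with $S_\alpha S_\beta\subseteq S_{\alpha\wedge\beta}$. The Rees matrix semigroup $\mathcal{M}[S;I,\Lambda;P]$ over the semigroup $S$ is the set $I\times S\times\Lambda$ with multiplication $(i,g,\lambda)(j,h,\mu)=(i,g\,p_{\lambda j}\,h,\mu)$. A semigroup is completely regular if each of its elements belongs to a subgroup of it (a subset which is a group under the semigroup operation). *)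

theory Defs
  imports "HOL-Algebra.Group" "HOL-Library.Disjoint_Sets"
begin

text \<open>
  The algebra library has no carrier-based semigroups (its weakest structure is a monoid), so a
  semigroup is represented here by a carrier set together with a binary operation. The carrier may
  be empty.
\<close>

definition semigroup_on :: "'a set \<Rightarrow> ('a \<Rightarrow> 'a \<Rightarrow> 'a) \<Rightarrow> bool" where
  "semigroup_on S f \<longleftrightarrow>
    (\<forall>x\<in>S. \<forall>y\<in>S. f x y \<in> S) \<and>
    (\<forall>x\<in>S. \<forall>y\<in>S. \<forall>z\<in>S. f (f x y) z = f x (f y z))"

text \<open>
  A subgroup of a semigroup is a subset that is a group under the restricted operation. Its
  identity \<open>e\<close> depends on the subset.
\<close>

definition subgroup_of_semigroup :: "'a set \<Rightarrow> 'a set \<Rightarrow> ('a \<Rightarrow> 'a \<Rightarrow> 'a) \<Rightarrow> bool" where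
  "subgroup_of_semigroup G S f \<longleftrightarrow>
    G \<subseteq> S \<and> (\<exists>e. group \<lparr>carrier = G, monoid.mult = f, one = e\<rparr>)"

definition completely_regular :: "'a set \<Rightarrow> ('a \<Rightarrow> 'a \<Rightarrow> 'a) \<Rightarrow> bool" where
  "completely_regular S f \<longleftrightarrow>
    semigroup_on S f \<and> (\<forall>x\<in>S. \<exists>G. subgroup_of_semigroup G S f \<and> x \<in> G)"

text \<open>The index semilattice \<open>Y\<close> is the type \<open>'y\<close>, and \<open>C \<alpha>\<close> is the group \<open>S\<^sub>\<alpha>\<close>.\<close>

definition semilattice_of_groups ::
    "'a set \<Rightarrow> ('a \<Rightarrow> 'a \<Rightarrow> 'a) \<Rightarrow> ('y::semilattice_inf \<Rightarrow> 'a set) \<Rightarrow> bool" where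
  "semilattice_of_groups S f C \<longleftrightarrow>
    semigroup_on S f \<and>
    S = (\<Union>\<alpha>. C \<alpha>) \<and> disjoint_family C \<and>
    (\<forall>\<alpha>. subgroup_of_semigroup (C \<alpha>) S f) \<and>
    (\<forall>\<alpha> \<beta>. \<forall>x\<in>C \<alpha>. \<forall>y\<in>C \<beta>. f x y \<in> C (inf \<alpha> \<beta>))"

definition rees_carrier :: "'a set \<Rightarrow> 'i set \<Rightarrow> 'l set \<Rightarrow> ('i \<times> 'a \<times> 'l) set" where
  "rees_carrier S I \<Lambda> = I \<times> S \<times> \<Lambda>"

definition rees_mult ::
    "('a \<Rightarrow> 'a \<Rightarrow> 'a) \<Rightarrow> ('l \<Rightarrow> 'i \<Rightarrow> 'a) \<Rightarrow>
      'i \<times> 'a \<times> 'l \<Rightarrow> 'i \<times> 'a \<times> 'l \<Rightarrow> 'i \<times> 'a \<times> 'l" where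
  "rees_mult f P = (\<lambda>(i, g, l) (j, h, m). (i, f (f g (P l j)) h, m))"

end

theory Submission
  imports Defs
begin

text \<open>
  The element \<open>(i, g, l)\<close> with \<open>g \<in> C \<alpha>\<close> lies in the set \<open>{i} \<times> C \<alpha> \<times> {l}\<close>, on which the
  multiplication only ever uses the single matrix entry \<open>p = P l i\<close>. Since \<open>p\<close> sits over the top of
  the semilattice, multiplying by it does not leave \<open>C \<alpha>\<close>; if \<open>e\<close> is the identity of \<open>C \<alpha>\<close>, then
  \<open>g p h = g (e p) h\<close> for \<open>g, h \<in> C \<alpha>\<close>, and \<open>e p\<close> is an element of the group \<open>C \<alpha>\<close>. So the product
  on \<open>{i} \<times> C \<alpha> \<times> {l}\<close> is the product of \<open>C \<alpha>\<close> with a fixed group element inserted between the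
  factors, and inserting a group element yields a group again
  (\<open>group_sandwich\<close>). Hence every element lies in a subgroup.
\<close>

text \<open>
  The map \<open>x \<mapsto> x \<otimes> a\<close> turns the new product into the old one, which is why \<open>inv a\<close> is the identity
  and why the inverse of \<open>x\<close> is \<open>inv a \<otimes> inv x \<otimes> inv a\<close>.
\<close>

lemma group_sandwich:
  fixes G (structure)
  assumes "group G" and a: "a \<in> carrier G"
  shows "group \<lparr>carrier = carrier G, monoid.mult = (\<lambda>x y. x \<otimes> a \<otimes> y), one = inv a\<rparr>"
proof -
  interpret group G by fact
  show ?thesis
  proof (rule groupI, goal_cases)
    case (5 x)
    with a have "inv a \<otimes> inv x \<otimes> inv a \<otimes> a \<otimes> x = inv a"
      by (simp add: m_assoc)
    with 5 a show ?case by (auto intro!: bexI[of _ "inv a \<otimes> inv x \<otimes> inv a"])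
  qed (use a in \<open>auto simp: m_assoc\<close>)
qed

lemma semigroup_on_rees:
  assumes S: "semigroup_on S f" and P: "\<And>l i. l \<in> \<Lambda> \<Longrightarrow> i \<in> I \<Longrightarrow> P l i \<in> S"
  shows "semigroup_on (rees_carrier S I \<Lambda>) (rees_mult f P)"
proof -
  have [simp]: "f x y \<in> S" if "x \<in> S" "y \<in> S" for x y
    using S that by (simp add: semigroup_on_def)
  have "f (f x y) z = f x (f y z)" if "x \<in> S" "y \<in> S" "z \<in> S" for x y z
    using S that by (simp add: semigroup_on_def)
  then show ?thesis
    unfolding semigroup_on_def rees_carrier_def by (auto simp: rees_mult_def P)
qed

text \<open>
  The entry \<open>P l i\<close> may lie outside \<open>G\<close>, but its product \<open>q\<close> with the identity of \<open>G\<close> lies in \<open>G\<close> and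
  acts in its place. So \<open>{i} \<times> G \<times> {l}\<close> is a copy of \<open>G\<close> with \<open>q\<close> inserted into every product.
\<close>

lemma subgroup_of_rees_block:
  assumes S: "semigroup_on S f" and G: "subgroup_of_semigroup G S f"
    and i: "i \<in> I" and l: "l \<in> \<Lambda>" and p: "P l i \<in> S"
    and pG: "\<And>g. g \<in> G \<Longrightarrow> f (P l i) g \<in> G"
  shows "subgroup_of_semigroup ({i} \<times> G \<times> {l}) (rees_carrier S I \<Lambda>) (rees_mult f P)"
proof -
  from G obtain e where GS: "G \<subseteq> S" and grp: "group \<lparr>carrier = G, monoid.mult = f, one = e\<rparr>"
    (is "group ?G") by (auto simp: subgroup_of_semigroup_def)
  interpret group ?G by (fact grp)
  define q where "q = f (P l i) e"
  have eG: "e \<in> G" using one_closed by simp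
  have unit: "f e h = h" if "h \<in> G" for h
    using l_one[of h] that by simp
  have q: "q \<in> carrier ?G"
    using one_closed pG by (simp add: q_def)
  have assoc: "f (f x y) z = f x (f y z)" if "x \<in> S" "y \<in> S" "z \<in> S" for x y z
    using S that by (simp add: semigroup_on_def)
  have closed: "f x y \<in> S" if "x \<in> S" "y \<in> S" for x y
    using S that by (simp add: semigroup_on_def)
  have sandwich: "f (f g q) h = f (f g (P l i)) h" if "g \<in> G" "h \<in> G" for g h
  proof -
    have "g \<in> S" "h \<in> S" "e \<in> S" using that eG GS by auto
    then have "f (f g q) h = f (f g (P l i)) (f e h)"
      using p by (simp add: q_def assoc closed)
    then show ?thesis using that by (simp add: unit)
  qed
  let ?H = "\<lparr>carrier = G, monoid.mult = (\<lambda>x y. f (f x q) y), one = inv\<^bsub>?G\<^esub> q\<rparr>"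
  interpret H: group ?H using group_sandwich[OF grp q] by simp
  \<comment> \<open>The identity of the target is arbitrary: taking the image of the homomorphism replaces it.\<close>
  let ?R = "\<lparr>carrier = {i} \<times> G \<times> {l}, monoid.mult = rees_mult f P, one = undefined\<rparr>"
  have "(\<lambda>g. (i, g, l)) \<in> hom ?H ?R"
    using H.m_closed by (auto simp: hom_def rees_mult_def sandwich)
  from H.hom_imp_img_group[OF this]
  have "\<exists>u. group \<lparr>carrier = {i} \<times> G \<times> {l}, monoid.mult = rees_mult f P, one = u\<rparr>"
    by (auto simp: image_def Times_insert_left intro: back_subst[of group])
  then show ?thesis
    using GS i l by (auto simp: subgroup_of_semigroup_def rees_carrier_def)
qed

theorem proposition1p3:
  fixes S :: "'a set" and f :: "'a \<Rightarrow> 'a \<Rightarrow> 'a"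
    and C :: "'y::bounded_semilattice_inf_top \<Rightarrow> 'a set"
    and I :: "'i set" and \<Lambda> :: "'l set" and P :: "'l \<Rightarrow> 'i \<Rightarrow> 'a"
  assumes "semilattice_of_groups S f C"
    and "\<And>\<alpha>. finite (C \<alpha>)"
    and "\<And>l i. l \<in> \<Lambda> \<Longrightarrow> i \<in> I \<Longrightarrow> P l i \<in> C top_class.top"
  shows "completely_regular (rees_carrier S I \<Lambda>) (rees_mult f P)"
proof -
  from assms(1) have S: "semigroup_on S f" and SC: "S = (\<Union>\<alpha>. C \<alpha>)"
    and sub: "\<And>\<alpha>. subgroup_of_semigroup (C \<alpha>) S f"
    and meet: "\<And>\<alpha> \<beta> x y. x \<in> C \<alpha> \<Longrightarrow> y \<in> C \<beta> \<Longrightarrow> f x y \<in> C (inf \<alpha> \<beta>)"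
    by (auto simp: semilattice_of_groups_def)
  have P: "P l i \<in> S" if "l \<in> \<Lambda>" "i \<in> I" for l i
    using assms(3)[OF that] SC by blast
  have "\<exists>G. subgroup_of_semigroup G (rees_carrier S I \<Lambda>) (rees_mult f P) \<and> x \<in> G"
    if "x \<in> rees_carrier S I \<Lambda>" for x
  proof -
    from that SC obtain i g l \<alpha> where x: "x = (i, g, l)" "i \<in> I" "l \<in> \<Lambda>" "g \<in> C \<alpha>"
      by (auto simp: rees_carrier_def)
    have "f (P l i) h \<in> C \<alpha>" if "h \<in> C \<alpha>" for h
      using meet[OF assms(3) that] x by simp
    then have "subgroup_of_semigroup ({i} \<times> C \<alpha> \<times> {l}) (rees_carrier S I \<Lambda>) (rees_mult f P)"
      using subgroup_of_rees_block[OF S sub] P x by metis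
    with x show ?thesis by blast
  qed
  with semigroup_on_rees[OF S P] show ?thesis
    by (simp add: completely_regular_def)
qed

end
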